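(* Let $V$ denote the space of all tuples $(F,G)$ in which $F$ is a smooth function of $\eta$ and a finite but unspecified number of the derivatives $w_{0l}$, $l\ge1$, and $G$ is a smooth function of $\xi$ and a finite but unspecified number of the derivatives $w_{k0}$, $k\ge1$ (all such tuples are conserved currents of the equation $w_{\xi\eta}=0$). Let $V_0$ denote the subspace of trivial conserved currents of this equation belonging to $V$. Then $V_0$ consists of the tuples that can be locally represented in the form $(F,G)$ with \[ F=\mathcal D_\eta\tilde F+Cw_{01},\qquad G=\mathcal D_\xi\tilde G-Cw_{10} \] for some smooth function $\tilde F$ of $\eta$ and a finite number of $w_{0l}$, $l\ge1$, some smooth function $\tilde G$ of $\xi$ and a finite number of $w_{k0}$, $k\ge1$, and some constant $C$, where \[ \mathcal D_\xi:=\partial_\xi+\sum_{k\ge1}w_{k+1,0}\partial_{w_{k0}},\qquad \mathcal D_\eta:=\partial_\eta+\sum_{l\ge1}w_{0,l+1}\partial_{w_{0l}} . \]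
   Context: The equation is $\mathcal W$: $w_{\xi\eta}=0$ for an unknown function $w=w(\xi,\eta)$. Write $w_{kl}:=\partial^{k+l}w/\partial\xi^k\partial\eta^l$, $k,l\in\mathbb N_0=\{0,1,2,\dots\}$ (so $w_{00}=w$), regarded as jet variables. A differential function of $w$ is a smooth function of $\xi$, $\eta$ and finitely many $w_{kl}$. The total derivative operators are $\mathrm D_\xi=\partial_\xi+\sum_{k,l\ge0}w_{k+1,l}\partial_{w_{kl}}$ and $\mathrm D_\eta=\partial_\eta+\sum_{k,l\ge0}w_{k,l+1}\partial_{w_{kl}}$. A differential function vanishes on solutions of $\mathcal W$ if it vanishes whenever $w_{kl}=0$ for all $k,l\ge1$. A conserved current of $\mathcal W$ is a pair $(F,G)$ of differential functions such that $\mathrm D_\xi F+\mathrm D_\eta G$ vanishes on solutions of $\mathcal W$. A conserved current is trivial if it is of the form $(F'+\mathrm D_\eta H,\,G'-\mathrm D_\xi H)$, where $F',G',H$ are differential functions and $F',G'$ vanish on solutions of $\mathcal W$. All considerations, including the notion of triviality, are local: differential functions may be restricted to a sufficiently small neighbourhood of a point of the solution set of $\mathcal W$ in the jet space. *)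

theory Defs
  imports "HOL-Analysis.Analysis"
begin

text \<open>
  A point of the (infinite) jet space is an assignment of real values to the coordinates
  \<open>\<xi>\<close>, \<open>\<eta>\<close> and \<open>w\<^sub>k\<^sub>l\<close>.  The jet space carries the product topology, so every neighbourhood of a
  point restricts only finitely many coordinates.
\<close>

datatype coord = Xi | Eta | W nat nat

type_synonym jet = "coord \<Rightarrow> real"

definition solution_set :: "jet set" where
  "solution_set = {x. \<forall>k\<ge>1. \<forall>l\<ge>1. x (W k l) = 0}"

definition pd :: "coord \<Rightarrow> (jet \<Rightarrow> real) \<Rightarrow> jet \<Rightarrow> real" where
  "pd c f x = deriv (\<lambda>t. f (x(c := t))) (x c)"

definition pds :: "coord list \<Rightarrow> (jet \<Rightarrow> real) \<Rightarrow> jet \<Rightarrow> real" where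
  "pds cs f = foldr pd cs f"

text \<open>
  \<open>smooth_fun_on A U f\<close>: on the open set \<open>U\<close>, \<open>f\<close> is a function of finitely many of the
  coordinates in \<open>A\<close>, and all its iterated partial derivatives exist and are continuous.
  For a function of finitely many coordinates this is ordinary \<open>C\<^sup>\<infinity>\<close> smoothness on the
  (open) projection of \<open>U\<close>; derivatives with respect to the other coordinates are zero.
\<close>

definition smooth_fun_on :: "coord set \<Rightarrow> jet set \<Rightarrow> (jet \<Rightarrow> real) \<Rightarrow> bool" where
  "smooth_fun_on A U f \<longleftrightarrow>
     open U \<and>
     (\<exists>B. finite B \<and> B \<subseteq> A \<and> (\<forall>x\<in>U. \<forall>y\<in>U. (\<forall>c\<in>B. x c = y c) \<longrightarrow> f x = f y)) \<and>
     (\<forall>cs. continuous_on U (pds cs f) \<and>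
           (\<forall>c. \<forall>x\<in>U. (\<lambda>t. pds cs f (x(c := t))) field_differentiable at (x c)))"

text \<open>
  Everything below is local at a point \<open>p\<close> of the jet space: a function stands for its germ
  at \<open>p\<close>, and all conditions and identities are required on some neighbourhood of \<open>p\<close> only.
\<close>

definition smooth_fun_at :: "coord set \<Rightarrow> jet \<Rightarrow> (jet \<Rightarrow> real) \<Rightarrow> bool" where
  "smooth_fun_at A p f \<longleftrightarrow> (\<exists>U. p \<in> U \<and> smooth_fun_on A U f)"

abbreviation differential_function :: "jet \<Rightarrow> (jet \<Rightarrow> real) \<Rightarrow> bool" where
  "differential_function \<equiv> smooth_fun_at UNIV"

definition vanishes_on_solutions :: "jet \<Rightarrow> (jet \<Rightarrow> real) \<Rightarrow> bool" where
  "vanishes_on_solutions p f \<longleftrightarrow> (\<forall>\<^sub>F x in nhds p. x \<in> solution_set \<longrightarrow> f x = 0)"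

text \<open>
  For a function of finitely many coordinates only finitely many summands
  of the following sums are nonzero.
\<close>

definition D_xi :: "(jet \<Rightarrow> real) \<Rightarrow> jet \<Rightarrow> real" where
  "D_xi f x = pd Xi f x + (\<Sum>\<^sub>\<infinity>(k, l)\<in>UNIV. x (W (k + 1) l) * pd (W k l) f x)"

definition D_eta :: "(jet \<Rightarrow> real) \<Rightarrow> jet \<Rightarrow> real" where
  "D_eta f x = pd Eta f x + (\<Sum>\<^sub>\<infinity>(k, l)\<in>UNIV. x (W k (l + 1)) * pd (W k l) f x)"

definition reduced_D_xi :: "(jet \<Rightarrow> real) \<Rightarrow> jet \<Rightarrow> real" where
  "reduced_D_xi f x = pd Xi f x + (\<Sum>\<^sub>\<infinity>k\<in>{1..}. x (W (k + 1) 0) * pd (W k 0) f x)"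

definition reduced_D_eta :: "(jet \<Rightarrow> real) \<Rightarrow> jet \<Rightarrow> real" where
  "reduced_D_eta f x = pd Eta f x + (\<Sum>\<^sub>\<infinity>l\<in>{1..}. x (W 0 (l + 1)) * pd (W 0 l) f x)"

definition conserved_currents :: "jet \<Rightarrow> ((jet \<Rightarrow> real) \<times> (jet \<Rightarrow> real)) set" where
  "conserved_currents p =
     {(F, G). differential_function p F \<and> differential_function p G \<and>
              vanishes_on_solutions p (\<lambda>x. D_xi F x + D_eta G x)}"

definition trivial_currents :: "jet \<Rightarrow> ((jet \<Rightarrow> real) \<times> (jet \<Rightarrow> real)) set" where
  "trivial_currents p =
     {(F, G) \<in> conserved_currents p.
        \<exists>F' G' H. differential_function p F' \<and> differential_function p G' \<and>
          differential_function p H \<and>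
          vanishes_on_solutions p F' \<and> vanishes_on_solutions p G' \<and>
          (\<forall>\<^sub>F x in nhds p. F x = F' x + D_eta H x \<and> G x = G' x - D_xi H x)}"

definition xi_coords :: "coord set" where
  "xi_coords = insert Xi {W k 0 | k. k \<ge> 1}"

definition eta_coords :: "coord set" where
  "eta_coords = insert Eta {W 0 l | l. l \<ge> 1}"

definition V :: "jet \<Rightarrow> ((jet \<Rightarrow> real) \<times> (jet \<Rightarrow> real)) set" where
  "V p = {(F, G). smooth_fun_at eta_coords p F \<and> smooth_fun_at xi_coords p G}"

definition V\<^sub>0 :: "jet \<Rightarrow> ((jet \<Rightarrow> real) \<times> (jet \<Rightarrow> real)) set" where
  "V\<^sub>0 p = V p \<inter> trivial_currents p"

end

theory Submission imports Defs begin

text \<open>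
  If a current of the stated form is given, the potential \<open>H = Ft - Gt + C w\<^sub>0\<^sub>0\<close> shows that it is trivial: every
  term of \<open>D_eta H\<close> and \<open>D_xi H\<close> that does not belong to \<open>F\<close> or \<open>-G\<close> contains a mixed derivative \<open>w\<^sub>k\<^sub>l\<close> with
  \<open>k, l \<ge> 1\<close> as a factor.

  Conversely, let \<open>F = F' + D_eta H\<close> and \<open>G = G' - D_xi H\<close>.  As \<open>F\<close> depends only on \<open>\<eta>\<close> and the \<open>w\<^sub>0\<^sub>l\<close> with \<open>l \<ge> 1\<close>, its
  value at \<open>x\<close> equals that at the point \<open>\<rho> x\<close> obtained from \<open>x\<close> by giving all other coordinates their
  values at \<open>p\<close>.  This is a solution point, so \<open>F'\<close> drops out and
  \<open>F x = D_eta H (\<rho> x) = reduced_D_eta (H \<circ> \<rho>) x + w\<^sub>0\<^sub>1 \<cdot> H\<^sub>w (\<rho> x)\<close>, where \<open>H\<^sub>w = \<partial>H/\<partial>w\<^sub>0\<^sub>0\<close>.  The last summand is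
  there because \<open>D_eta\<close> differentiates by \<open>w\<^sub>0\<^sub>0\<close> and the reduced operator does not.  The same works for
  \<open>G\<close>, and what remains is that \<open>H\<^sub>w\<close> has the value \<open>C = H\<^sub>w p\<close> at all the points \<open>\<rho> x\<close>, in either direction.

  On solutions \<open>D_eta\<close> is the operator \<open>\<partial>\<^sub>\<eta> + (\<Sum>l. w\<^sub>0\<^sub>,\<^sub>l\<^sub>+\<^sub>1 \<partial>/\<partial>w\<^sub>0\<^sub>l)\<close> along the chain \<open>w\<^sub>0\<^sub>0, w\<^sub>0\<^sub>1, \<dots>\<close>.  Since \<open>F\<close> does
  not depend on \<open>w\<^sub>0\<^sub>0\<close>, the difference between \<open>H\<close> and its translate along \<open>w\<^sub>0\<^sub>0\<close> is in the kernel of this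
  operator.  The kernel consists of functions constant along the chain (\<open>chain_kernel\<close>): the
  equation contains the next variable after the highest one present only linearly, with the
  derivative by that highest variable as coefficient.  Thus the difference quotients of \<open>H\<close> in the
  direction \<open>w\<^sub>0\<^sub>0\<close>, and with them \<open>H\<^sub>w\<close>, do not change along the chain
  (\<open>chain_derivative_potential\<close>).  Only first derivatives of \<open>H\<close> are used.
\<close>

section \<open>Partial derivatives and smoothness on the jet space\<close>

lemma continuous_on_fun_upd: "continuous_on UNIV (\<lambda>t. (x :: jet)(c := t))"
proof (rule continuous_on_coordinatewise_then_product)
  fix i show "continuous_on UNIV (\<lambda>t. (x(c := t)) i)"
    by (cases "i = c") auto
qed

lemma eventually_fun_upd_in_open:
  fixes U :: "jet set"
  assumes "open U" "x \<in> U"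
  shows "\<forall>\<^sub>F t in nhds (x c). x(c := t) \<in> U"
proof -
  have "open ((\<lambda>t. x(c := t)) -` U)"
    using continuous_on_fun_upd assms(1) by (simp add: continuous_on_open_vimage)
  moreover have "x c \<in> (\<lambda>t. x(c := t)) -` U"
    using assms(2) by simp
  ultimately show ?thesis
    unfolding eventually_nhds by blast
qed

lemma pd_cong_open:
  assumes "open U" "x \<in> U" "\<And>y. y \<in> U \<Longrightarrow> f y = g y"
  shows "pd c f x = pd c g x"
  unfolding pd_def
  by (intro deriv_cong_ev eventually_mono[OF eventually_fun_upd_in_open[OF assms(1,2)]])
     (use assms(3) in auto)

text \<open>
  Iterated differentiability is stratified by the order, with a recursion that peels off the
  innermost derivative.  Sums, products and restrictions then stay in each class by induction on
  the order.
\<close>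

definition has_partials_on :: "jet set \<Rightarrow> (jet \<Rightarrow> real) \<Rightarrow> bool" where
  "has_partials_on U f \<longleftrightarrow> continuous_on U f \<and>
     (\<forall>c. \<forall>x\<in>U. (\<lambda>t. f (x(c := t))) field_differentiable at (x c))"

primrec has_partials_upto :: "jet set \<Rightarrow> nat \<Rightarrow> (jet \<Rightarrow> real) \<Rightarrow> bool" where
  "has_partials_upto U 0 f \<longleftrightarrow> has_partials_on U f"
| "has_partials_upto U (Suc n) f \<longleftrightarrow> has_partials_on U f \<and> (\<forall>c. has_partials_upto U n (pd c f))"

lemma has_partials_upto_iff:
  "has_partials_upto U n f \<longleftrightarrow> (\<forall>cs. length cs \<le> n \<longrightarrow> has_partials_on U (pds cs f))"
proof (induction n arbitrary: f)
  case 0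
  then show ?case by (simp add: pds_def)
next
  case (Suc n)
  have snoc: "pds (cs @ [c]) f = pds cs (pd c f)" for cs c
    by (simp add: pds_def)
  have nil: "pds [] f = f" by (simp add: pds_def)
  show ?case
  proof
    assume *: "has_partials_upto U (Suc n) f"
    show "\<forall>cs. length cs \<le> Suc n \<longrightarrow> has_partials_on U (pds cs f)"
    proof (intro allI impI)
      fix cs :: "coord list" assume "length cs \<le> Suc n"
      then show "has_partials_on U (pds cs f)"
        using * by (cases cs rule: rev_cases) (auto simp: Suc.IH snoc nil)
    qed
  next
    assume *: "\<forall>cs. length cs \<le> Suc n \<longrightarrow> has_partials_on U (pds cs f)"
    have "has_partials_on U f" using *[rule_format, of "[]"] by (simp add: nil)
    moreover have "has_partials_on U (pds cs (pd c f))" if "length cs \<le> n" for cs c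
      using *[rule_format, of "cs @ [c]"] that by (simp add: snoc)
    ultimately show "has_partials_upto U (Suc n) f"
      by (simp add: Suc.IH)
  qed
qed

lemma has_partials_upto_base: "has_partials_upto U n f \<Longrightarrow> has_partials_on U f"
  by (cases n) auto

lemma has_partials_upto_Suc_D: "has_partials_upto U (Suc n) f \<Longrightarrow> has_partials_upto U n f"
  by (simp add: has_partials_upto_iff)

lemma has_partials_on_cong:
  assumes "open U" "\<And>y. y \<in> U \<Longrightarrow> f y = g y" "has_partials_on U f"
  shows "has_partials_on U g"
  unfolding has_partials_on_def
proof (intro conjI allI ballI)
  show "continuous_on U g"
    using assms continuous_on_cong[of U U f g] by (auto simp: has_partials_on_def)
next
  fix c x assume x: "x \<in> U"
  have ev: "\<forall>\<^sub>F t in nhds (x c). f (x(c := t)) = g (x(c := t))"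
    using eventually_fun_upd_in_open[OF assms(1) x]
    by eventually_elim (use assms(2) in auto)
  show "(\<lambda>t. g (x(c := t))) field_differentiable at (x c)"
    using assms(3) x DERIV_cong_ev[OF refl ev refl]
    unfolding has_partials_on_def field_differentiable_def by blast
qed

lemma has_partials_upto_cong:
  assumes "open U" "\<And>y. y \<in> U \<Longrightarrow> f y = g y" "has_partials_upto U n f"
  shows "has_partials_upto U n g"
  using assms(2,3)
proof (induction n arbitrary: f g)
  case 0
  have "has_partials_on U g"
    by (rule has_partials_on_cong[OF assms(1), of f]) (use 0 in auto)
  then show ?case by simp
next
  case (Suc n)
  have "has_partials_on U g"
    by (rule has_partials_on_cong[OF assms(1), of f]) (use Suc.prems in auto)
  moreover have "has_partials_upto U n (pd c g)" for c
  proof (rule Suc.IH)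
    show "pd c f y = pd c g y" if "y \<in> U" for y
      using pd_cong_open[OF assms(1) that Suc.prems(1)] .
    show "has_partials_upto U n (pd c f)"
      using Suc.prems(2) by simp
  qed
  ultimately show ?case by simp
qed

lemma has_partials_upto_subset:
  assumes "U' \<subseteq> U" "has_partials_upto U n f"
  shows "has_partials_upto U' n f"
  using assms(2)
proof (induction n arbitrary: f)
  have "has_partials_on U' f" if "has_partials_on U f" for f
    using that assms(1) continuous_on_subset[of U f U'] by (auto simp: has_partials_on_def)
  note base = this
  {
    case 0
    then show ?case using base by simp
  next
    case (Suc n)
    then show ?case using base by simp
  }
qed

lemma pd_add:
  assumes "has_partials_on U f" "has_partials_on U g" "x \<in> U"
  shows "pd c (\<lambda>x. f x + g x) x = pd c f x + pd c g x"
proof -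
  have "(\<lambda>t. f (x(c := t))) field_differentiable at (x c)"
    "(\<lambda>t. g (x(c := t))) field_differentiable at (x c)"
    using assms by (simp_all add: has_partials_on_def)
  from deriv_add[OF this] show ?thesis by (simp add: pd_def)
qed

lemma pd_mult:
  assumes "has_partials_on U f" "has_partials_on U g" "x \<in> U"
  shows "pd c (\<lambda>x. f x * g x) x = f x * pd c g x + pd c f x * g x"
proof -
  have "(\<lambda>t. f (x(c := t))) field_differentiable at (x c)"
    "(\<lambda>t. g (x(c := t))) field_differentiable at (x c)"
    using assms by (simp_all add: has_partials_on_def)
  from deriv_mult[OF this] show ?thesis by (simp add: pd_def)
qed

lemma has_partials_on_add:
  assumes "has_partials_on U f" "has_partials_on U g"
  shows "has_partials_on U (\<lambda>x. f x + g x)"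
  using assms unfolding has_partials_on_def
  by (auto intro!: continuous_intros field_differentiable_add)

lemma has_partials_on_mult:
  assumes "has_partials_on U f" "has_partials_on U g"
  shows "has_partials_on U (\<lambda>x. f x * g x)"
  using assms unfolding has_partials_on_def
  by (auto intro!: continuous_intros field_differentiable_mult)

lemma has_partials_upto_add:
  assumes "open U" "has_partials_upto U n f" "has_partials_upto U n g"
  shows "has_partials_upto U n (\<lambda>x. f x + g x)"
  using assms(2,3)
proof (induction n arbitrary: f g)
  case 0
  then show ?case by (simp add: has_partials_on_add)
next
  case (Suc n)
  have "has_partials_upto U n (pd c (\<lambda>x. f x + g x))" for c
  proof (rule has_partials_upto_cong[OF assms(1)])
    show "has_partials_upto U n (\<lambda>x. pd c f x + pd c g x)"
      using Suc by simp
  qed (use Suc.prems pd_add in auto)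
  then show ?case using Suc.prems by (simp add: has_partials_on_add)
qed

text \<open>
  By the Leibniz rule the first partial derivatives are again sums of products, with one factor
  differentiable only to the lower order, so the induction also needs that a function of order
  \<open>n + 1\<close> is one of order \<open>n\<close>.
\<close>

lemma has_partials_upto_mult:
  assumes "open U" "has_partials_upto U n f" "has_partials_upto U n g"
  shows "has_partials_upto U n (\<lambda>x. f x * g x)"
  using assms(2,3)
proof (induction n arbitrary: f g)
  case 0
  then show ?case by (simp add: has_partials_on_mult)
next
  case (Suc n)
  have "has_partials_upto U n (pd c (\<lambda>x. f x * g x))" for c
  proof (rule has_partials_upto_cong[OF assms(1)])
    show "has_partials_upto U n (\<lambda>x. f x * pd c g x + pd c f x * g x)"
      using Suc.prems has_partials_upto_Suc_D
      by (intro has_partials_upto_add[OF assms(1)] Suc.IH) auto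
  qed (use Suc.prems pd_mult in auto)
  then show ?case using Suc.prems by (simp add: has_partials_on_mult)
qed

lemma has_partials_upto_const: "has_partials_upto U n (\<lambda>_. k)"
proof (induction n arbitrary: k)
  case 0
  then show ?case by (simp add: has_partials_on_def)
next
  case (Suc n)
  have "pd c (\<lambda>_. k) = (\<lambda>_. 0)" for c by (simp add: pd_def fun_eq_iff)
  with Suc show ?case by (simp add: has_partials_on_def)
qed

lemma has_partials_upto_coordinate: "has_partials_upto U n (\<lambda>x. x d)"
proof -
  have base: "has_partials_on U (\<lambda>x. x d)"
    unfolding has_partials_on_def
  proof (intro conjI allI ballI)
    show "continuous_on U (\<lambda>x. x d)"
      by (rule continuous_on_subset[OF continuous_on_product_coordinates subset_UNIV])
    fix c and x :: jet
    show "(\<lambda>t. (x(c := t)) d) field_differentiable at (x c)"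
      by (cases "c = d") auto
  qed
  have "pd c (\<lambda>x. x d) = (\<lambda>_. if c = d then 1 else 0)" for c
    by (simp add: pd_def fun_eq_iff)
  with base show ?thesis
    by (cases n) (auto simp: has_partials_upto_const)
qed

text \<open>
  \<open>override_on p x A\<close> keeps the coordinates of \<open>x\<close> in \<open>A\<close> and freezes the others at their values in
  \<open>p\<close>.  Freezing either leaves a coordinate line alone or collapses it to a point, so no chain
  rule is needed to differentiate a restricted function.
\<close>

lemma pd_override_on:
  "pd c (\<lambda>x. f (override_on p x A)) = (\<lambda>x. if c \<in> A then pd c f (override_on p x A) else 0)"
proof
  fix x
  have "override_on p (x(c := t)) A =
        (if c \<in> A then (override_on p x A)(c := t) else override_on p x A)" for t
    by (auto simp: override_on_def)
  then show "pd c (\<lambda>x. f (override_on p x A)) x =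
             (if c \<in> A then pd c f (override_on p x A) else 0)"
    by (auto simp: pd_def)
qed

lemma continuous_on_override_on: "continuous_on UNIV (\<lambda>x :: jet. override_on p x A)"
proof (rule continuous_on_coordinatewise_then_product)
  fix i show "continuous_on UNIV (\<lambda>x. override_on p x A i)"
    by (cases "i \<in> A") (auto simp: override_on_def)
qed

lemma has_partials_upto_override_on:
  assumes "has_partials_upto U n f"
  shows "has_partials_upto ((\<lambda>x. override_on p x A) -` U) n (\<lambda>x. f (override_on p x A))"
  using assms
proof (induction n arbitrary: f)
  have base: "has_partials_on ((\<lambda>x. override_on p x A) -` U) (\<lambda>x. f (override_on p x A))"
    if f: "has_partials_on U f" for f
    unfolding has_partials_on_def
  proof (intro conjI allI ballI)
    show "continuous_on ((\<lambda>x. override_on p x A) -` U) (\<lambda>x. f (override_on p x A))"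
      using f continuous_on_compose2[of U f _ "\<lambda>x. override_on p x A"]
        continuous_on_subset[OF continuous_on_override_on]
      by (auto simp: has_partials_on_def)
    fix c x assume x: "x \<in> (\<lambda>x. override_on p x A) -` U"
    have *: "override_on p (x(c := t)) A =
          (if c \<in> A then (override_on p x A)(c := t) else override_on p x A)" for t
      by (auto simp: override_on_def)
    have "(\<lambda>t. f ((override_on p x A)(c := t))) field_differentiable at (override_on p x A c)"
      using f x by (auto simp: has_partials_on_def)
    then show "(\<lambda>t. f (override_on p (x(c := t)) A)) field_differentiable at (x c)"
      unfolding * by (cases "c \<in> A") auto
  qed
  {
    case 0
    then show ?case using base by simp
  next
    case (Suc n)
    have "has_partials_upto ((\<lambda>x. override_on p x A) -` U) n
            (pd c (\<lambda>x. f (override_on p x A)))" for c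
      using Suc.IH[of "pd c f"] Suc.prems
      by (cases "c \<in> A") (simp_all add: pd_override_on has_partials_upto_const)
    then show ?case using base[of f] Suc.prems by simp
  }
qed

definition depends_on :: "coord set \<Rightarrow> jet set \<Rightarrow> (jet \<Rightarrow> real) \<Rightarrow> bool" where
  "depends_on B U f \<longleftrightarrow> (\<forall>x\<in>U. \<forall>y\<in>U. (\<forall>c\<in>B. x c = y c) \<longrightarrow> f x = f y)"

lemma depends_onD:
  "depends_on B U f \<Longrightarrow> x \<in> U \<Longrightarrow> y \<in> U \<Longrightarrow> (\<And>c. c \<in> B \<Longrightarrow> x c = y c) \<Longrightarrow> f x = f y"
  unfolding depends_on_def by blast

lemma depends_on_mono: "depends_on B U f \<Longrightarrow> B \<subseteq> B' \<Longrightarrow> U' \<subseteq> U \<Longrightarrow> depends_on B' U' f"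
  unfolding depends_on_def by blast

lemma smooth_fun_on_iff:
  "smooth_fun_on A U f \<longleftrightarrow>
     open U \<and> (\<exists>B. finite B \<and> B \<subseteq> A \<and> depends_on B U f) \<and> (\<forall>n. has_partials_upto U n f)"
proof -
  have "(\<forall>n. has_partials_upto U n f) \<longleftrightarrow> (\<forall>cs. has_partials_on U (pds cs f))"
    unfolding has_partials_upto_iff by (meson order_refl)
  then show ?thesis
    unfolding smooth_fun_on_def depends_on_def has_partials_on_def by simp
qed

lemma pd_eq_0:
  assumes "open U" "depends_on B U f" "c \<notin> B" "x \<in> U"
  shows "pd c f x = 0"
proof -
  have "\<forall>\<^sub>F t in nhds (x c). f (x(c := t)) = f x"
    using eventually_fun_upd_in_open[OF assms(1,4)]
    by eventually_elim (rule depends_onD[OF assms(2)], use assms(3,4) in auto)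
  then have "deriv (\<lambda>t. f (x(c := t))) (x c) = deriv (\<lambda>_. f x) (x c)"
    by (intro deriv_cong_ev) auto
  then show ?thesis by (simp add: pd_def)
qed

text \<open>
  The values of the coordinate \<open>c\<close> itself may differ at the two points when \<open>c\<close> is not in \<open>B\<close>, but then
  both derivatives vanish.
\<close>

lemma depends_on_pd:
  assumes "open U" "depends_on B U f"
  shows "depends_on B U (pd c f)"
  unfolding depends_on_def
proof (intro ballI impI)
  fix x y assume xy: "x \<in> U" "y \<in> U" "\<forall>c\<in>B. x c = y c"
  show "pd c f x = pd c f y"
  proof (cases "c \<in> B")
    case True
    then have eq: "x c = y c" using xy by auto
    have "\<forall>\<^sub>F t in nhds (x c). f (x(c := t)) = f (y(c := t))"
      using eventually_fun_upd_in_open[OF assms(1) xy(1), of c]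
        eventually_fun_upd_in_open[OF assms(1) xy(2), of c, folded eq]
      by eventually_elim (rule depends_onD[OF assms(2)], use xy(3) in auto)
    then show ?thesis unfolding pd_def using eq by (intro deriv_cong_ev) auto
  next
    case False
    then show ?thesis using pd_eq_0[OF assms] xy by simp
  qed
qed

lemma smooth_fun_on_subset:
  assumes "smooth_fun_on A U f" "open U'" "U' \<subseteq> U" "A \<subseteq> A'"
  shows "smooth_fun_on A' U' f"
proof -
  obtain B where "finite B" "B \<subseteq> A" "depends_on B U f"
    using assms(1) unfolding smooth_fun_on_iff by blast
  then have "finite B" "B \<subseteq> A'" "depends_on B U' f"
    using assms(4) depends_on_mono[OF _ subset_refl assms(3)] by auto
  then show ?thesis
    using assms(1,2) has_partials_upto_subset[OF assms(3)] unfolding smooth_fun_on_iff by blast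
qed

lemma smooth_fun_on_pd: "smooth_fun_on A U f \<Longrightarrow> smooth_fun_on A U (pd c f)"
  unfolding smooth_fun_on_iff
  using depends_on_pd has_partials_upto.simps(2) by blast

lemma smooth_fun_on_cong:
  assumes "smooth_fun_on A U f" "\<And>x. x \<in> U \<Longrightarrow> f x = g x"
  shows "smooth_fun_on A U g"
proof -
  have "depends_on B U g" if "depends_on B U f" for B
    using that assms(2) unfolding depends_on_def by metis
  then show ?thesis
    using assms has_partials_upto_cong[of U f g] unfolding smooth_fun_on_iff by blast
qed

lemma smooth_fun_on_combine:
  assumes "smooth_fun_on A U f" "smooth_fun_on A U g"
    and "\<And>n. has_partials_upto U n (\<lambda>x. h (f x) (g x))"
  shows "smooth_fun_on A U (\<lambda>x. h (f x) (g x))"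
proof -
  obtain B B' where B: "finite B" "B \<subseteq> A" "depends_on B U f"
    and B': "finite B'" "B' \<subseteq> A" "depends_on B' U g"
    using assms unfolding smooth_fun_on_iff by blast
  have "depends_on (B \<union> B') U (\<lambda>x. h (f x) (g x))"
    unfolding depends_on_def
  proof (intro ballI impI)
    fix x y assume "x \<in> U" "y \<in> U" "\<forall>c\<in>B \<union> B'. x c = y c"
    then have "f x = f y" "g x = g y"
      by (auto intro: depends_onD[OF B(3)] depends_onD[OF B'(3)])
    then show "h (f x) (g x) = h (f y) (g y)" by simp
  qed
  with assms B B' show ?thesis
    unfolding smooth_fun_on_iff by (meson finite_UnI Un_least)
qed

lemma smooth_fun_on_add:
  assumes "smooth_fun_on A U f" "smooth_fun_on A U g"
  shows "smooth_fun_on A U (\<lambda>x. f x + g x)"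
  using smooth_fun_on_combine[OF assms, of "(+)"] has_partials_upto_add assms
  by (simp add: smooth_fun_on_iff)

lemma smooth_fun_on_mult:
  assumes "smooth_fun_on A U f" "smooth_fun_on A U g"
  shows "smooth_fun_on A U (\<lambda>x. f x * g x)"
  using smooth_fun_on_combine[OF assms, of "(*)"] has_partials_upto_mult assms
  by (simp add: smooth_fun_on_iff)

lemma smooth_fun_atE:
  assumes "smooth_fun_at A p f"
  obtains U B where "open U" "p \<in> U" "finite B" "B \<subseteq> A" "depends_on B U f"
    "smooth_fun_on A U f" "has_partials_on U f"
proof -
  obtain U where U: "p \<in> U" "smooth_fun_on A U f"
    using assms unfolding smooth_fun_at_def by blast
  then obtain B where B: "open U" "finite B" "B \<subseteq> A" "depends_on B U f" "has_partials_upto U 0 f"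
    unfolding smooth_fun_on_iff by blast
  show thesis
    using that[OF B(1) U(1) B(2-4) U(2)] B(5) by simp
qed

lemma smooth_fun_at_common:
  assumes "smooth_fun_at A p f" "smooth_fun_at A' p g"
  obtains U where "p \<in> U" "smooth_fun_on A U f" "smooth_fun_on A' U g"
proof -
  obtain U U' where U: "p \<in> U" "smooth_fun_on A U f" "p \<in> U'" "smooth_fun_on A' U' g"
    using assms unfolding smooth_fun_at_def by blast
  then have "open (U \<inter> U')" by (auto simp: smooth_fun_on_iff)
  then have "smooth_fun_on A (U \<inter> U') f" "smooth_fun_on A' (U \<inter> U') g"
    using U smooth_fun_on_subset[OF _ _ _ subset_refl, of _ _ _ "U \<inter> U'"] by blast+
  then show thesis using U that[of "U \<inter> U'"] by simp
qed

lemma smooth_fun_at_mono: "smooth_fun_at A p f \<Longrightarrow> A \<subseteq> A' \<Longrightarrow> smooth_fun_at A' p f"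
  unfolding smooth_fun_at_def smooth_fun_on_iff by (meson subset_trans)

lemma smooth_fun_at_add:
  "smooth_fun_at A p f \<Longrightarrow> smooth_fun_at A p g \<Longrightarrow> smooth_fun_at A p (\<lambda>x. f x + g x)"
  by (erule (1) smooth_fun_at_common) (auto simp: smooth_fun_at_def intro: smooth_fun_on_add)

lemma smooth_fun_at_mult:
  "smooth_fun_at A p f \<Longrightarrow> smooth_fun_at A p g \<Longrightarrow> smooth_fun_at A p (\<lambda>x. f x * g x)"
  by (erule (1) smooth_fun_at_common) (auto simp: smooth_fun_at_def intro: smooth_fun_on_mult)

lemma smooth_fun_at_pd: "smooth_fun_at A p f \<Longrightarrow> smooth_fun_at A p (pd c f)"
  unfolding smooth_fun_at_def using smooth_fun_on_pd by blast

lemma smooth_fun_at_const: "smooth_fun_at A p (\<lambda>_. k)"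
  unfolding smooth_fun_at_def smooth_fun_on_iff
  by (intro exI[of _ UNIV])
    (auto simp: has_partials_upto_const depends_on_def intro!: exI[of _ "{}"])

lemma smooth_fun_at_coordinate: "d \<in> A \<Longrightarrow> smooth_fun_at A p (\<lambda>x. x d)"
  unfolding smooth_fun_at_def smooth_fun_on_iff
  by (intro exI[of _ UNIV])
    (auto simp: has_partials_upto_coordinate depends_on_def intro!: exI[of _ "{d}"])

lemma smooth_fun_at_cmult: "smooth_fun_at A p f \<Longrightarrow> smooth_fun_at A p (\<lambda>x. k * f x)"
  by (intro smooth_fun_at_mult smooth_fun_at_const)

lemma smooth_fun_at_sum:
  assumes "\<And>i. i \<in> K \<Longrightarrow> smooth_fun_at A p (f i)"
  shows "smooth_fun_at A p (\<lambda>x. \<Sum>i\<in>K. f i x)"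
  using assms
  by (induction K rule: infinite_finite_induct)
    (auto simp: smooth_fun_at_const intro!: smooth_fun_at_add)

lemma smooth_fun_at_cong:
  assumes "smooth_fun_at A p f" "\<forall>\<^sub>F x in nhds p. f x = g x"
  shows "smooth_fun_at A p g"
proof -
  obtain U U' where U: "p \<in> U" "smooth_fun_on A U f" "open U'" "p \<in> U'"
    "\<And>x. x \<in> U' \<Longrightarrow> f x = g x"
    using assms unfolding smooth_fun_at_def eventually_nhds by blast
  then have "open (U \<inter> U')" by (auto simp: smooth_fun_on_iff)
  then have "smooth_fun_on A (U \<inter> U') f"
    using smooth_fun_on_subset[OF U(2) _ _ subset_refl] by blast
  then have "smooth_fun_on A (U \<inter> U') g"
    using U(5) by (rule smooth_fun_on_cong) auto
  then show ?thesis
    using U unfolding smooth_fun_at_def by blast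
qed

lemma smooth_fun_at_override_on:
  assumes "smooth_fun_at UNIV p f"
  shows "smooth_fun_at A p (\<lambda>x. f (override_on p x A))"
proof -
  obtain U B where U: "open U" "p \<in> U" "finite B" "depends_on B U f" "smooth_fun_on UNIV U f"
    using smooth_fun_atE[OF assms] by metis
  define U' where "U' = (\<lambda>x. override_on p x A) -` U"
  have "open U'"
    using continuous_on_override_on U(1) by (simp add: continuous_on_open_vimage U'_def)
  moreover have "p \<in> U'"
  proof -
    have "override_on p p A = p" by (auto simp: override_on_def)
    then show ?thesis using U(2) by (simp add: U'_def)
  qed
  moreover have "depends_on (B \<inter> A) U' (\<lambda>x. f (override_on p x A))"
    unfolding depends_on_def
  proof (intro ballI impI)
    fix x y assume xy: "x \<in> U'" "y \<in> U'" "\<forall>c\<in>B \<inter> A. x c = y c"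
    show "f (override_on p x A) = f (override_on p y A)"
      by (rule depends_onD[OF U(4)]) (use xy in \<open>auto simp: U'_def override_on_def\<close>)
  qed
  moreover have "has_partials_upto U' n (\<lambda>x. f (override_on p x A))" for n
    using U(5) unfolding U'_def smooth_fun_on_iff by (blast intro: has_partials_upto_override_on)
  ultimately show ?thesis
    unfolding smooth_fun_at_def smooth_fun_on_iff using U(3)
    by (blast intro: finite_Int)
qed

section \<open>Total derivatives\<close>

text \<open>
  The full operators, the reduced ones and the chain operators used below all have the form
  \<open>\<partial>\<^sub>c + (\<Sum>i\<in>I. sh i \<cdot> \<partial>\<^bsub>e i\<^esub>)\<close> so linearity,
  smoothness and comparison are established once for this form.
\<close>

definition total_derivative ::
  "coord \<Rightarrow> 'i set \<Rightarrow> ('i \<Rightarrow> coord) \<Rightarrow> ('i \<Rightarrow> coord) \<Rightarrow> (jet \<Rightarrow> real) \<Rightarrow> jet \<Rightarrow> real" where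
  "total_derivative c I e sh f x = pd c f x + (\<Sum>\<^sub>\<infinity>i\<in>I. x (sh i) * pd (e i) f x)"

lemma D_eta_eq_total_derivative:
  "D_eta = total_derivative Eta UNIV (\<lambda>(k, l). W k l) (\<lambda>(k, l). W k (l + 1))"
  by (simp add: fun_eq_iff D_eta_def total_derivative_def case_prod_unfold)

lemma D_xi_eq_total_derivative:
  "D_xi = total_derivative Xi UNIV (\<lambda>(k, l). W k l) (\<lambda>(k, l). W (k + 1) l)"
  by (simp add: fun_eq_iff D_xi_def total_derivative_def case_prod_unfold)

lemma reduced_D_eta_eq_total_derivative:
  "reduced_D_eta = total_derivative Eta {1..} (W 0) (\<lambda>l. W 0 (l + 1))"
  by (simp add: fun_eq_iff reduced_D_eta_def total_derivative_def)

lemma reduced_D_xi_eq_total_derivative: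
  "reduced_D_xi = total_derivative Xi {1..} (\<lambda>k. W k 0) (\<lambda>k. W (k + 1) 0)"
  by (simp add: fun_eq_iff reduced_D_xi_def total_derivative_def)

lemma inj_W: "inj (\<lambda>(k, l). W k l)" "inj_on (W 0) I" "inj_on (\<lambda>k. W k 0) I"
  by (auto simp: inj_on_def)

text \<open>
  Two operators of this form agree on a function as soon as the summands that only one of them has
  vanish, either because the function does not depend on \<open>e i\<close> or because the coordinate \<open>sh i\<close> is zero.
\<close>

lemma total_derivative_reindex:
  assumes "inj_on h J" "h ` J \<subseteq> I"
    and "\<And>i. i \<in> I - h ` J \<Longrightarrow> x (sh i) * pd (e i) f x = 0"
  shows "total_derivative c I e sh f x = total_derivative c J (e \<circ> h) (sh \<circ> h) f x"
proof -
  have "(\<Sum>\<^sub>\<infinity>i\<in>I. x (sh i) * pd (e i) f x) = (\<Sum>\<^sub>\<infinity>i\<in>h ` J. x (sh i) * pd (e i) f x)"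
    using assms(2,3) by (intro infsum_cong_neutral) auto
  also have "\<dots> = (\<Sum>\<^sub>\<infinity>j\<in>J. x (sh (h j)) * pd (e (h j)) f x)"
    by (simp add: infsum_reindex[OF assms(1)] comp_def)
  finally show ?thesis by (simp add: total_derivative_def)
qed

lemma total_derivative_eq_sum:
  assumes "inj_on e I" "finite B" "open U" "depends_on B U f" "x \<in> U"
  shows "total_derivative c I e sh f x = pd c f x + (\<Sum>i\<in>e -` B \<inter> I. x (sh i) * pd (e i) f x)"
proof -
  have "total_derivative c I e sh f x = total_derivative c (e -` B \<inter> I) (e \<circ> id) (sh \<circ> id) f x"
    using pd_eq_0[OF assms(3,4) _ assms(5)] by (intro total_derivative_reindex) auto
  then show ?thesis
    using finite_vimage_IntI[OF assms(2,1)] by (simp add: total_derivative_def)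
qed

lemma smooth_fun_at_total_derivative:
  assumes "inj_on e I" "smooth_fun_at A p f" "A \<subseteq> A'"
    and "\<And>i. i \<in> I \<Longrightarrow> e i \<in> A \<Longrightarrow> sh i \<in> A'"
  shows "smooth_fun_at A' p (total_derivative c I e sh f)"
proof -
  obtain U B where UB: "open U" "p \<in> U" "finite B" "B \<subseteq> A" "depends_on B U f"
    using smooth_fun_atE[OF assms(2)] by metis
  have f: "smooth_fun_at A' p (pd c f)" for c
    using assms(2,3) smooth_fun_at_mono smooth_fun_at_pd by blast
  show ?thesis
  proof (rule smooth_fun_at_cong)
    show "smooth_fun_at A' p (\<lambda>x. pd c f x + (\<Sum>i\<in>e -` B \<inter> I. x (sh i) * pd (e i) f x))"
      using UB assms(4)
      by (intro smooth_fun_at_add smooth_fun_at_sum smooth_fun_at_mult f smooth_fun_at_coordinate)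
        auto
    show "\<forall>\<^sub>F x in nhds p. pd c f x + (\<Sum>i\<in>e -` B \<inter> I. x (sh i) * pd (e i) f x)
            = total_derivative c I e sh f x"
      unfolding eventually_nhds
      using UB total_derivative_eq_sum[OF assms(1) UB(3,1,5)] by metis
  qed
qed

lemma total_derivative_add:
  assumes "inj_on e I" "smooth_fun_at A p f" "smooth_fun_at A' p g"
  shows "\<forall>\<^sub>F x in nhds p. total_derivative c I e sh (\<lambda>x. f x + g x) x
           = total_derivative c I e sh f x + total_derivative c I e sh g x"
proof -
  obtain U where U: "p \<in> U" "smooth_fun_on A U f" "smooth_fun_on A' U g"
    using smooth_fun_at_common[OF assms(2,3)] by blast
  then obtain B B' where B: "open U" "finite B" "depends_on B U f" "finite B'" "depends_on B' U g"
    unfolding smooth_fun_on_iff by blast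
  have partials: "has_partials_on U f" "has_partials_on U g"
    using U has_partials_upto_base unfolding smooth_fun_on_iff by blast+
  define B'' where "B'' = B \<union> B'"
  have B'': "finite B''" "depends_on B'' U f" "depends_on B'' U g"
    using B(2,4) depends_on_mono[OF B(3) _ subset_refl] depends_on_mono[OF B(5) _ subset_refl]
    unfolding B''_def by auto
  have add: "depends_on B'' U (\<lambda>x. f x + g x)"
    unfolding depends_on_def
  proof (intro ballI impI)
    fix x y assume "x \<in> U" "y \<in> U" "\<forall>c\<in>B''. x c = y c"
    then have "f x = f y" "g x = g y"
      by (auto intro: depends_onD[OF B''(2)] depends_onD[OF B''(3)])
    then show "f x + g x = f y + g y" by simp
  qed
  show ?thesis
    unfolding eventually_nhds
  proof (intro exI conjI ballI)
    fix x assume x: "x \<in> U"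
    note expand = total_derivative_eq_sum[OF assms(1) B''(1) B(1) _ x]
    show "total_derivative c I e sh (\<lambda>x. f x + g x) x
           = total_derivative c I e sh f x + total_derivative c I e sh g x"
      unfolding expand[OF B''(2)] expand[OF B''(3)] expand[OF add]
      by (simp add: pd_add[OF partials x] sum.distrib ring_distribs)
  qed (use U B in auto)
qed

lemma total_derivative_cmult:
  assumes "smooth_fun_at A p f"
  shows "\<forall>\<^sub>F x in nhds p. total_derivative c I e sh (\<lambda>x. k * f x) x
           = k * total_derivative c I e sh f x"
proof -
  obtain U where U: "open U" "p \<in> U" "has_partials_on U f"
    using smooth_fun_atE[OF assms] by metis
  have k: "has_partials_on U (\<lambda>_. k)"
    using has_partials_upto_base[OF has_partials_upto_const] .
  have pd_k: "pd c (\<lambda>_. k) x = 0" for c x by (simp add: pd_def)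
  have "total_derivative c I e sh (\<lambda>x. k * f x) x = k * total_derivative c I e sh f x"
    if "x \<in> U" for x
    by (simp add: total_derivative_def pd_mult[OF k U(3) that] pd_k mult.left_commute[of _ k]
        infsum_cmult_right' ring_distribs)
  with U show ?thesis unfolding eventually_nhds by blast
qed

lemma eventually_pd_eq_0:
  assumes "smooth_fun_at A p f"
  shows "\<forall>\<^sub>F x in nhds p. \<forall>c. c \<notin> A \<longrightarrow> pd c f x = 0"
proof -
  obtain U B where U: "open U" "p \<in> U" and "finite B" and B: "B \<subseteq> A" "depends_on B U f"
    and "smooth_fun_on A U f" "has_partials_on U f"
    by (rule smooth_fun_atE[OF assms])
  have "pd c f x = 0" if "x \<in> U" "c \<notin> A" for x c
    using pd_eq_0[OF U(1) B(2)] B(1) that by blast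
  with U show ?thesis unfolding eventually_nhds by blast
qed

lemma D_eta_coordinate: "D_eta (\<lambda>x. x (W 0 0)) x = x (W 0 1)"
proof -
  have pd: "pd c (\<lambda>x. x (W 0 0)) x = (if c = W 0 0 then 1 else 0)" for c
    by (simp add: pd_def)
  have "D_eta (\<lambda>x. x (W 0 0)) x =
      total_derivative Eta {(0, 0)} ((\<lambda>(k, l). W k l) \<circ> id) ((\<lambda>(k, l). W k (l + 1)) \<circ> id)
        (\<lambda>x. x (W 0 0)) x"
    unfolding D_eta_eq_total_derivative by (rule total_derivative_reindex) (auto simp: pd)
  then show ?thesis by (simp add: total_derivative_def pd)
qed

lemma D_xi_coordinate: "D_xi (\<lambda>x. x (W 0 0)) x = x (W 1 0)"
proof -
  have pd: "pd c (\<lambda>x. x (W 0 0)) x = (if c = W 0 0 then 1 else 0)" for c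
    by (simp add: pd_def)
  have "D_xi (\<lambda>x. x (W 0 0)) x =
      total_derivative Xi {(0, 0)} ((\<lambda>(k, l). W k l) \<circ> id) ((\<lambda>(k, l). W (k + 1) l) \<circ> id)
        (\<lambda>x. x (W 0 0)) x"
    unfolding D_xi_eq_total_derivative by (rule total_derivative_reindex) (auto simp: pd)
  then show ?thesis by (simp add: total_derivative_def pd)
qed

lemma W_in_coords:
  "W k l \<in> eta_coords \<longleftrightarrow> k = 0 \<and> l \<ge> 1" "W k l \<in> xi_coords \<longleftrightarrow> l = 0 \<and> k \<ge> 1"
  "Eta \<in> eta_coords" "Xi \<in> xi_coords" "Xi \<notin> eta_coords" "Eta \<notin> xi_coords"
  by (auto simp: eta_coords_def xi_coords_def)

text \<open>
  The only derivatives of such a function are those by \<open>\<eta>\<close> and by \<open>w\<^sub>0\<^sub>l\<close> with \<open>l \<ge> 1\<close>.  The former does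
  not enter \<open>D_xi\<close>, and the latter enter it with the factors \<open>w\<^sub>1\<^sub>l\<close>, which are zero on solutions.
\<close>

lemma D_xi_vanishes_on_solutions:
  assumes "smooth_fun_at eta_coords p f"
  shows "vanishes_on_solutions p (D_xi f)"
  unfolding vanishes_on_solutions_def
  using eventually_pd_eq_0[OF assms]
proof eventually_elim
  case (elim x)
  show ?case
  proof
    assume x: "x \<in> solution_set"
    have "x (W (k + 1) l) * pd (W k l) f x = 0" for k l
      using elim x by (cases "W k l \<in> eta_coords") (auto simp: W_in_coords solution_set_def)
    then show "D_xi f x = 0"
      using elim by (simp add: D_xi_def W_in_coords infsum_0 case_prod_unfold)
  qed
qed

lemma D_eta_vanishes_on_solutions:
  assumes "smooth_fun_at xi_coords p f"
  shows "vanishes_on_solutions p (D_eta f)"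
  unfolding vanishes_on_solutions_def
  using eventually_pd_eq_0[OF assms]
proof eventually_elim
  case (elim x)
  show ?case
  proof
    assume x: "x \<in> solution_set"
    have "x (W k (l + 1)) * pd (W k l) f x = 0" for k l
      using elim x by (cases "W k l \<in> xi_coords") (auto simp: W_in_coords solution_set_def)
    then show "D_eta f x = 0"
      using elim by (simp add: D_eta_def W_in_coords infsum_0 case_prod_unfold)
  qed
qed

lemma D_eta_eq_reduced:
  assumes "smooth_fun_at eta_coords p f"
  shows "\<forall>\<^sub>F x in nhds p. D_eta f x = reduced_D_eta f x"
  using eventually_pd_eq_0[OF assms]
proof eventually_elim
  case (elim x)
  have "D_eta f x = total_derivative Eta {1..} ((\<lambda>(k, l). W k l) \<circ> Pair 0)
          ((\<lambda>(k, l). W k (l + 1)) \<circ> Pair 0) f x"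
    unfolding D_eta_eq_total_derivative
  proof (rule total_derivative_reindex)
    fix i :: "nat \<times> nat"
    assume "i \<in> UNIV - Pair 0 ` {1..}"
    then have "(case i of (k, l) \<Rightarrow> W k l) \<notin> eta_coords"
      by (cases i) (auto simp: W_in_coords image_iff)
    then show "x (case i of (k, l) \<Rightarrow> W k (l + 1)) * pd (case i of (k, l) \<Rightarrow> W k l) f x = 0"
      using elim by simp
  qed (auto simp: inj_on_def)
  then show ?case by (simp add: reduced_D_eta_eq_total_derivative comp_def)
qed

lemma D_xi_eq_reduced:
  assumes "smooth_fun_at xi_coords p f"
  shows "\<forall>\<^sub>F x in nhds p. D_xi f x = reduced_D_xi f x"
  using eventually_pd_eq_0[OF assms]
proof eventually_elim
  case (elim x)
  have "D_xi f x = total_derivative Xi {1..} ((\<lambda>(k, l). W k l) \<circ> (\<lambda>k. (k, 0)))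
          ((\<lambda>(k, l). W (k + 1) l) \<circ> (\<lambda>k. (k, 0))) f x"
    unfolding D_xi_eq_total_derivative
  proof (rule total_derivative_reindex)
    fix i :: "nat \<times> nat"
    assume "i \<in> UNIV - (\<lambda>k. (k, 0)) ` {1..}"
    then have "(case i of (k, l) \<Rightarrow> W k l) \<notin> xi_coords"
      by (cases i) (auto simp: W_in_coords image_iff)
    then show "x (case i of (k, l) \<Rightarrow> W (k + 1) l) * pd (case i of (k, l) \<Rightarrow> W k l) f x = 0"
      using elim by simp
  qed (auto simp: inj_on_def)
  then show ?case by (simp add: reduced_D_xi_eq_total_derivative comp_def)
qed

section \<open>Differentiation along a chain of coordinates\<close>

text \<open>
  On solutions, \<open>D_eta\<close> involves only the chain \<open>z = w\<^sub>0\<^sub>0, w\<^sub>0\<^sub>1, w\<^sub>0\<^sub>2, \<dots>\<close>, where each variable is the derivative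
  of its predecessor, together with the independent variable \<open>\<eta>\<close>.  The same holds for \<open>D_xi\<close>, \<open>\<xi>\<close> and
  \<open>w\<^sub>0\<^sub>0, w\<^sub>1\<^sub>0, w\<^sub>2\<^sub>0, \<dots>\<close>.  An abstract chain treats both cases at once.
\<close>

abbreviation chain_derivative :: "coord \<Rightarrow> (nat \<Rightarrow> coord) \<Rightarrow> (jet \<Rightarrow> real) \<Rightarrow> jet \<Rightarrow> real" where
  "chain_derivative c z \<equiv> total_derivative c UNIV z (\<lambda>l. z (Suc l))"

lemma chain_derivative_eq_sum:
  assumes "\<And>l. l \<ge> L \<Longrightarrow> pd (z l) f x = 0"
  shows "chain_derivative c z f x = pd c f x + (\<Sum>l<L. x (z (Suc l)) * pd (z l) f x)"
proof -
  have "chain_derivative c z f x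
      = total_derivative c {..<L} (z \<circ> id) ((\<lambda>l. z (Suc l)) \<circ> id) f x"
    using assms by (intro total_derivative_reindex) auto
  then show ?thesis by (simp add: total_derivative_def)
qed

lemma D_eta_eq_chain_derivative:
  assumes "x \<in> solution_set"
  shows "D_eta f x = chain_derivative Eta (W 0) f x"
proof -
  have "D_eta f x = total_derivative Eta UNIV ((\<lambda>(k, l). W k l) \<circ> Pair 0)
          ((\<lambda>(k, l). W k (l + 1)) \<circ> Pair 0) f x"
    unfolding D_eta_eq_total_derivative
  proof (rule total_derivative_reindex)
    fix i :: "nat \<times> nat"
    assume "i \<in> UNIV - range (Pair 0)"
    then show "x (case i of (k, l) \<Rightarrow> W k (l + 1)) * pd (case i of (k, l) \<Rightarrow> W k l) f x = 0"
      using assms by (cases i; cases "fst i") (auto simp: solution_set_def)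
  qed (auto simp: inj_on_def)
  then show ?thesis by (simp add: comp_def)
qed

lemma D_xi_eq_chain_derivative:
  assumes "x \<in> solution_set"
  shows "D_xi f x = chain_derivative Xi (\<lambda>k. W k 0) f x"
proof -
  have "D_xi f x = total_derivative Xi UNIV ((\<lambda>(k, l). W k l) \<circ> (\<lambda>k. (k, 0)))
          ((\<lambda>(k, l). W (k + 1) l) \<circ> (\<lambda>k. (k, 0))) f x"
    unfolding D_xi_eq_total_derivative
  proof (rule total_derivative_reindex)
    fix i :: "nat \<times> nat"
    assume "i \<in> UNIV - range (\<lambda>k. (k, 0))"
    then show "x (case i of (k, l) \<Rightarrow> W (k + 1) l) * pd (case i of (k, l) \<Rightarrow> W k l) f x = 0"
      using assms by (cases i; cases "snd i") (auto simp: solution_set_def)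
  qed (auto simp: inj_on_def)
  then show ?thesis by (simp add: comp_def)
qed

text \<open>
  The chain starts at \<open>w\<^sub>0\<^sub>0\<close>, whereas the reduced operator starts at \<open>w\<^sub>0\<^sub>1\<close>.
\<close>

lemma reduced_D_eta_eq_chain_derivative:
  assumes "pd (W 0 0) f x = 0"
  shows "chain_derivative Eta (W 0) f x = reduced_D_eta f x"
proof -
  have "chain_derivative Eta (W 0) f x
      = total_derivative Eta {1..} (W 0 \<circ> id) ((\<lambda>l. W 0 (Suc l)) \<circ> id) f x"
    by (rule total_derivative_reindex) (use assms in \<open>auto simp: not_less_eq_eq\<close>)
  then show ?thesis by (simp add: reduced_D_eta_eq_total_derivative comp_def)
qed

lemma reduced_D_xi_eq_chain_derivative:
  assumes "pd (W 0 0) f x = 0"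
  shows "chain_derivative Xi (\<lambda>k. W k 0) f x = reduced_D_xi f x"
proof -
  have "chain_derivative Xi (\<lambda>k. W k 0) f x
      = total_derivative Xi {1..} ((\<lambda>k. W k 0) \<circ> id) ((\<lambda>k. W (Suc k) 0) \<circ> id) f x"
    by (rule total_derivative_reindex) (use assms in \<open>auto simp: not_less_eq_eq\<close>)
  then show ?thesis by (simp add: reduced_D_xi_eq_total_derivative comp_def)
qed

section \<open>The kernel of a chain derivative\<close>

text \<open>
  The region \<open>M\<close> will be a slice of a neighbourhood on which the coordinates outside the chain are
  frozen.  It is not open in the jet space, so only its sections by the coordinate lines of the chain
  are required to be open and convex, and all arguments move one coordinate at a time.
\<close>

locale chain_region =
  fixes c\<^sub>0 :: coord and z :: "nat \<Rightarrow> coord" and M :: "jet set" and D :: "jet \<Rightarrow> real"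
  assumes inj: "inj z" and c\<^sub>0: "c\<^sub>0 \<notin> range z"
    and line: "\<And>x c. x \<in> M \<Longrightarrow> c \<in> insert c\<^sub>0 (range z) \<Longrightarrow>
      open {t. x(c := t) \<in> M} \<and> convex {t. x(c := t) \<in> M}"
    and diff: "\<And>x c. x \<in> M \<Longrightarrow> (\<lambda>t. D (x(c := t))) field_differentiable at (x c)"
begin

lemma constant_along_line:
  assumes zero: "\<And>x. x \<in> M \<Longrightarrow> pd c D x = 0" and c: "c \<in> insert c\<^sub>0 (range z)"
    and x: "x \<in> M" "x(c := t) \<in> M"
  shows "D (x(c := t)) = D x"
proof -
  let ?S = "{t. x(c := t) \<in> M}"
  have "((\<lambda>t. D (x(c := t))) has_field_derivative 0) (at u within ?S)" if u: "u \<in> ?S" for u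
  proof -
    have "((\<lambda>t. D (x(c := t))) has_field_derivative 0) (at u)"
      using field_differentiable_derivI[OF diff, of "x(c := u)" c] zero[of "x(c := u)"] u
      by (simp add: pd_def)
    then show ?thesis by (rule has_field_derivative_at_within)
  qed
  then obtain k where "\<And>u. u \<in> ?S \<Longrightarrow> D (x(c := u)) = k"
    using has_field_derivative_zero_constant[of ?S "\<lambda>t. D (x(c := t))"] line[OF x(1) c] by blast
  from this[of t] this[of "x c"] x show ?thesis by simp
qed

lemma pd_constant_along_line:
  assumes zero: "\<And>x. x \<in> M \<Longrightarrow> pd c D x = 0"
    and c: "c \<in> insert c\<^sub>0 (range z)" "d \<in> insert c\<^sub>0 (range z)" "d \<noteq> c"
    and x: "x \<in> M" "x(c := v) \<in> M"
  shows "pd d D (x(c := v)) = pd d D x"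
proof -
  let ?y = "x(c := v)"
  have ev: "\<forall>\<^sub>F t in nhds (y d). y(d := t) \<in> M" if "y \<in> M" for y
    unfolding eventually_nhds using line[OF that c(2)] that
    by (intro exI[of _ "{t. y(d := t) \<in> M}"]) auto
  have "?y d = x d" using c(3) by simp
  with ev[OF x(2)] have "\<forall>\<^sub>F t in nhds (x d). ?y(d := t) \<in> M" by metis
  with ev[OF x(1)] have "\<forall>\<^sub>F t in nhds (x d). D (?y(d := t)) = D (x(d := t))"
  proof eventually_elim
    case (elim t)
    then show "D (?y(d := t)) = D (x(d := t))"
      using constant_along_line[OF zero c(1), of "x(d := t)" v] c(3) by (simp add: fun_upd_twist)
  qed
  then show ?thesis
    unfolding pd_def using c(3) by (intro deriv_cong_ev) auto
qed

text \<open>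
  A function annihilated by a chain derivative is constant along the whole chain.  Descend from the
  highest chain variable \<open>z m\<close> on which \<open>D\<close> may depend.  Then no derivative of \<open>D\<close> depends on \<open>z (m + 1)\<close>,
  and this coordinate enters the equation only as the factor of \<open>\<partial>\<^bsub>z m\<^esub> D\<close>.  Changing the value of
  \<open>z (m + 1)\<close> and subtracting the two equations isolates that derivative, which must vanish.
  Working with a difference of values, rather than differentiating the equation, avoids second
  derivatives.
\<close>

lemma chain_kernel:
  assumes eq: "\<And>x. x \<in> M \<Longrightarrow> pd c\<^sub>0 D x + (\<Sum>l<L. x (z (Suc l)) * pd (z l) D x) = 0"
    and high: "\<And>x l. x \<in> M \<Longrightarrow> l \<ge> L \<Longrightarrow> pd (z l) D x = 0"
    and "x \<in> M" "c \<in> insert c\<^sub>0 (range z)"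
  shows "pd c D x = 0"
proof -
  have z: "\<forall>l. L \<le> l + k \<longrightarrow> (\<forall>x\<in>M. pd (z l) D x = 0)" for k
  proof (induction k)
    case 0
    then show ?case using high by simp
  next
    case (Suc k)
    \<comment> \<open>The derivatives by \<open>z l\<close> are already known to vanish for \<open>l + k \<ge> L\<close>; the new index \<open>m\<close> has
      \<open>m + k + 1 = L\<close>.\<close>
    show ?case
    proof (intro allI impI ballI)
      fix m x assume m: "L \<le> m + Suc k" and x: "x \<in> M"
      show "pd (z m) D x = 0"
      proof (cases "L \<le> m + k")
        case True
        then show ?thesis using Suc x by blast
      next
        case False
        with m have mL: "m < L" and above: "\<And>l y. l > m \<Longrightarrow> y \<in> M \<Longrightarrow> pd (z l) D y = 0"
          using Suc by auto
        let ?c = "z (Suc m)"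
        have "open {t. x(?c := t) \<in> M}" using line[OF x] by blast
        then have "{t. x(?c := t) \<in> M} \<noteq> {x ?c}"
          using not_open_singleton[of "x ?c"] by metis
        moreover have "x ?c \<in> {t. x(?c := t) \<in> M}" using x by simp
        ultimately obtain v where v: "v \<noteq> x ?c" "x(?c := v) \<in> M" by blast
        have same: "pd d D (x(?c := v)) = pd d D x"
          if "d \<noteq> ?c" "d \<in> insert c\<^sub>0 (range z)" for d
          by (rule pd_constant_along_line) (use above x v that in auto)
        have "(x(?c := v)) (z (Suc l)) * pd (z l) D (x(?c := v)) - x (z (Suc l)) * pd (z l) D x
            = (if l = m then (v - x ?c) * pd (z m) D x else 0)" for l
        proof (cases "l > m")
          case True
          then show ?thesis using above x v by simp
        next
          case False
          then have "pd (z l) D (x(?c := v)) = pd (z l) D x"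
            by (intro same) (auto simp: inj_eq[OF inj])
          then show ?thesis by (simp add: inj_eq[OF inj] left_diff_distrib)
        qed
        then have "(\<Sum>l<L. (x(?c := v)) (z (Suc l)) * pd (z l) D (x(?c := v)))
            - (\<Sum>l<L. x (z (Suc l)) * pd (z l) D x) = (v - x ?c) * pd (z m) D x"
          using mL by (simp add: sum_subtractf[symmetric])
        moreover have "pd c\<^sub>0 D (x(?c := v)) = pd c\<^sub>0 D x"
          by (rule same) (use c\<^sub>0 in auto)
        ultimately have "(v - x ?c) * pd (z m) D x = 0"
          using eq[OF x] eq[OF v(2)] by linarith
        then show ?thesis using v(1) by simp
      qed
    qed
  qed
  then have "\<And>l. pd (z l) D x = 0"
    using assms(3) z[of L] by simp
  with eq[OF assms(3)] assms(4) show ?thesis by auto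
qed

end

section \<open>Neighbourhoods in the product topology\<close>

text \<open>
  In the product topology these cubes over finitely many coordinates form a neighbourhood base.
  They are convenient because their coordinate sections are balls or whole lines and because
  replacing coordinates of a point by those of the centre does not leave them.
\<close>

definition cylinder :: "jet \<Rightarrow> coord set \<Rightarrow> real \<Rightarrow> jet set" where
  "cylinder p B r = {x. \<forall>c\<in>B. \<bar>x c - p c\<bar> < r}"

lemma open_contains_cylinder:
  fixes U :: "jet set"
  assumes "open U" "p \<in> U"
  obtains B r where "finite B" "r > 0" "cylinder p B r \<subseteq> U"
proof -
  have "openin (product_topology (\<lambda>_. euclidean) UNIV) U"
    using assms(1) by (simp add: open_fun_def)
  then obtain X where X: "p \<in> Pi\<^sub>E UNIV X" "\<And>c. open (X c)"
    "finite {c. X c \<noteq> (UNIV :: real set)}" "Pi\<^sub>E UNIV X \<subseteq> U"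
    using product_topology_open_contains_basis[of "\<lambda>_. euclidean" UNIV U p] assms(2)
    by auto
  define B where "B = {c. X c \<noteq> UNIV}"
  have "\<exists>e>0. \<forall>t. \<bar>t - p c\<bar> < e \<longrightarrow> t \<in> X c" for c
    using X(1) X(2)[of c] by (fastforce simp: open_dist dist_real_def PiE_iff)
  then obtain e where e: "\<And>c. e c > 0" "\<And>c t. \<bar>t - p c\<bar> < e c \<Longrightarrow> t \<in> X c"
    by metis
  define r where "r = Min (insert 1 (e ` B))"
  have "finite B" using X(3) by (simp add: B_def)
  then have r: "r > 0" "\<And>c. c \<in> B \<Longrightarrow> r \<le> e c"
    using e(1) by (auto simp: r_def)
  have "cylinder p B r \<subseteq> Pi\<^sub>E UNIV X"
  proof
    fix x assume x: "x \<in> cylinder p B r"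
    have "x c \<in> X c" for c
    proof (cases "c \<in> B")
      case True
      then show ?thesis using x r(2)[of c] e(2)[of "x c" c] by (force simp: cylinder_def)
    next
      case False
      then show ?thesis by (simp add: B_def)
    qed
    then show "x \<in> Pi\<^sub>E UNIV X" by auto
  qed
  then have "cylinder p B r \<subseteq> U" using X(4) by (rule subset_trans)
  then show thesis by (rule that[OF \<open>finite B\<close> r(1)])
qed

lemma eventually_in_cylinder:
  assumes "finite B" "r > 0"
  shows "\<forall>\<^sub>F x in nhds p. x \<in> cylinder p B r"
proof -
  have "\<forall>\<^sub>F x in nhds p. \<bar>x c - p c\<bar> < r" for c
  proof -
    have "open ((\<lambda>x :: jet. x c) -` ball (p c) r)"
      by (intro open_vimage open_ball continuous_on_product_coordinates)
    then show ?thesis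
      using assms(2) unfolding eventually_nhds
      by (intro exI[of _ "(\<lambda>x :: jet. x c) -` ball (p c) r"]) (auto simp: dist_real_def)
  qed
  then show ?thesis
    using assms(1) by (simp add: cylinder_def eventually_ball_finite)
qed

section \<open>Recovering a current from its potential\<close>

text \<open>
  This is applied along both the \<open>\<xi>\<close> and the \<open>\<eta>\<close> chain, with \<open>z 0 = w\<^sub>0\<^sub>0\<close>.  Since \<open>F\<close>
  is not affected by freezing the coordinates outside \<open>A\<close>, its equation can be read at the frozen
  point, where all summands except that of \<open>z 0\<close> form the chain derivative of the frozen potential.
  The remaining summand is \<open>z 1\<close> times \<open>\<partial>\<^bsub>z 0\<^esub> H\<close> at the frozen point, and the content of the lemma is
  that this factor is constant.  Indeed, neither \<open>F\<close> nor the coefficients of the chain derivative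
  contain \<open>z 0\<close>, hence the difference of \<open>H\<close> and its translate along \<open>z 0\<close> is annihilated by the
  chain derivative and is constant along the chain.  As this holds for all short translations, the
  values of \<open>H\<close> on two lines in the direction \<open>z 0\<close> differ by a constant, and the derivatives agree.
\<close>

lemma chain_derivative_potential:
  fixes p :: jet and z :: "nat \<Rightarrow> coord" and c\<^sub>0 :: coord
  defines "A \<equiv> insert c\<^sub>0 (z ` {1..})"
  assumes inj: "inj z" and c\<^sub>0: "c\<^sub>0 \<notin> range z"
    and H: "smooth_fun_at UNIV p H" and F: "smooth_fun_at A p F"
    and eq: "\<forall>\<^sub>F x in nhds p. (\<forall>c. c \<notin> insert c\<^sub>0 (range z) \<longrightarrow> x c = p c) \<longrightarrow>
      F x = chain_derivative c\<^sub>0 z H x"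
  shows "\<forall>\<^sub>F x in nhds p. F x =
    chain_derivative c\<^sub>0 z (\<lambda>x. H (override_on p x A)) x + pd (z 0) H p * x (z 1)"
proof -
  let ?T = "{x :: jet. \<forall>c. c \<notin> insert c\<^sub>0 (range z) \<longrightarrow> x c = p c}"
  obtain U\<^sub>H B\<^sub>H where UH: "open U\<^sub>H" "p \<in> U\<^sub>H" "finite B\<^sub>H" "B\<^sub>H \<subseteq> UNIV" "depends_on B\<^sub>H U\<^sub>H H"
    "smooth_fun_on UNIV U\<^sub>H H" "has_partials_on U\<^sub>H H"
    by (rule smooth_fun_atE[OF H])
  obtain U\<^sub>F B\<^sub>F where UF: "open U\<^sub>F" "p \<in> U\<^sub>F" "finite B\<^sub>F" "B\<^sub>F \<subseteq> A" "depends_on B\<^sub>F U\<^sub>F F"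
    "smooth_fun_on A U\<^sub>F F" "has_partials_on U\<^sub>F F"
    by (rule smooth_fun_atE[OF F])
  obtain U\<^sub>E where UE: "open U\<^sub>E" "p \<in> U\<^sub>E"
    "\<And>x. x \<in> U\<^sub>E \<Longrightarrow> x \<in> ?T \<Longrightarrow> F x = chain_derivative c\<^sub>0 z H x"
    using eq unfolding eventually_nhds by auto
  obtain B r where B: "finite B" "r > 0" "cylinder p B r \<subseteq> U\<^sub>H \<inter> U\<^sub>F \<inter> U\<^sub>E"
  proof (rule open_contains_cylinder)
    show "open (U\<^sub>H \<inter> U\<^sub>F \<inter> U\<^sub>E)" using UH(1) UF(1) UE(1) by auto
    show "p \<in> U\<^sub>H \<inter> U\<^sub>F \<inter> U\<^sub>E" using UH(2) UF(2) UE(2) by auto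
  qed
  define N where "N = cylinder p B r \<inter> ?T"
  \<comment> \<open>Half the radius, so that translations of \<open>M\<close> by less than \<open>r / 2\<close> stay in \<open>N\<close>.\<close>
  define M where "M = cylinder p B (r / 2) \<inter> ?T"
  have N_sub: "x \<in> U\<^sub>H" "x \<in> U\<^sub>F" "x \<in> U\<^sub>E" "x \<in> ?T" if "x \<in> N" for x
    using that B(3) by (auto simp: N_def)
  have M_N: "x \<in> N" if "x \<in> M" for x
    using that B(2) unfolding M_def N_def cylinder_def by fastforce
  have p_M: "p \<in> M"
    using B(2) by (simp add: M_def cylinder_def)

  obtain K where K: "\<And>l. z l \<in> B\<^sub>H \<Longrightarrow> l \<le> K"
  proof -
    have "finite (z -` B\<^sub>H)" using UH(3) inj by (rule finite_vimageI)
    then show thesis using that[of "Max (z -` B\<^sub>H)"] by simp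
  qed
  have pd_high: "pd (z l) H x = 0" if "l \<ge> Suc K" "x \<in> N" for l x
    using pd_eq_0[OF UH(1,5)] N_sub(1)[OF that(2)] K[of l] that(1) by force
  have F_eq: "F x = pd c\<^sub>0 H x + (\<Sum>l<Suc K. x (z (Suc l)) * pd (z l) H x)" if "x \<in> N" for x
    using UE(3)[OF N_sub(3,4)[OF that]] chain_derivative_eq_sum[of "Suc K" z H x] pd_high that
    by simp
  have F_cong: "F x = F y" if "x \<in> cylinder p B r" "y \<in> cylinder p B r" "\<And>c. c \<in> A \<Longrightarrow> x c = y c"
    for x y
    by (rule depends_onD[OF UF(5)]) (use that B(3) UF(4) in auto)
  have z0: "z 0 \<notin> A"
    using inj c\<^sub>0 by (auto simp: A_def inj_eq)

  define \<tau> where "\<tau> s x = x(z 0 := x (z 0) + s)" for s and x :: jet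
  have \<tau>_N: "\<tau> s x \<in> N" if "x \<in> M" "\<bar>s\<bar> < r / 2" for s x
    unfolding N_def cylinder_def
  proof (intro IntI CollectI ballI)
    fix c assume "c \<in> B"
    then have "\<bar>x c - p c\<bar> < r / 2" using that by (simp add: M_def cylinder_def)
    then have "\<bar>x c + s - p c\<bar> < r" "\<bar>x c - p c\<bar> < r" using that(2) by linarith+
    then show "\<bar>\<tau> s x c - p c\<bar> < r" by (cases "c = z 0") (simp_all add: \<tau>_def)
  qed (use that in \<open>auto simp: M_def \<tau>_def\<close>)

  have shift_constant: "H (\<tau> s x) - H x = H (\<tau> s p) - H p" if x: "x \<in> M" and s: "\<bar>s\<bar> < r / 2" for s x
  proof -
    define D where "D x = H (\<tau> s x) - H x" for x
    \<comment> \<open>Translation along \<open>z 0\<close> commutes with moving any coordinate, up to a shift of the parameter if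
      that coordinate is \<open>z 0\<close> itself.\<close>
    have partial: "((\<lambda>t. D (y(c := t))) has_field_derivative pd c H (\<tau> s y) - pd c H y) (at (y c))"
      if y: "y \<in> M" for y c
    proof -
      let ?d = "if c = z 0 then s else 0"
      have H_partial: "((\<lambda>t. H (u(c := t))) has_field_derivative pd c H u) (at (u c))"
        if "u \<in> N" for u
        using UH(7) N_sub(1)[OF that]
        by (simp add: pd_def has_partials_on_def DERIV_deriv_iff_field_differentiable)
      have "\<tau> s (y(c := t)) = (\<tau> s y)(c := t + ?d)" for t
        by (auto simp: \<tau>_def)
      moreover have "((\<lambda>t. H ((\<tau> s y)(c := t + ?d))) has_field_derivative pd c H (\<tau> s y)) (at (y c))"
      proof -
        have "\<tau> s y c = y c + ?d" by (simp add: \<tau>_def)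
        with H_partial[OF \<tau>_N[OF y s]] show ?thesis
          using DERIV_shift[of "\<lambda>t. H ((\<tau> s y)(c := t))" "pd c H (\<tau> s y)" "y c" ?d] by metis
      qed
      ultimately show ?thesis
        unfolding D_def using H_partial[OF M_N[OF y]] by (auto intro!: DERIV_diff)
    qed
    have pd_D: "pd c D y = pd c H (\<tau> s y) - pd c H y" if "y \<in> M" for y c
      using DERIV_imp_deriv[OF partial[OF that]] by (simp add: pd_def)
    interpret chain_region c\<^sub>0 z M D
    proof
      show "inj z" "c\<^sub>0 \<notin> range z" by fact+
      fix y c assume y: "y \<in> M"
      show "(\<lambda>t. D (y(c := t))) field_differentiable at (y c)"
        using partial[OF y] field_differentiable_def by blast
      assume c: "c \<in> insert c\<^sub>0 (range z)"
      have "y(c := t) \<in> M \<longleftrightarrow> (c \<in> B \<longrightarrow> \<bar>t - p c\<bar> < r / 2)" for t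
        using y c unfolding M_def cylinder_def by auto
      then have "{t. y(c := t) \<in> M} = (if c \<in> B then ball (p c) (r / 2) else UNIV)"
        by (auto simp: dist_real_def abs_minus_commute)
      then show "open {t. y(c := t) \<in> M} \<and> convex {t. y(c := t) \<in> M}"
        by simp
    qed
    have eq_D: "pd c\<^sub>0 D y + (\<Sum>l<Suc K. y (z (Suc l)) * pd (z l) D y) = 0" if y: "y \<in> M" for y
    proof -
      have "F (\<tau> s y) = F y"
        using \<tau>_N[OF y s] M_N[OF y] z0 by (intro F_cong) (auto simp: N_def \<tau>_def)
      moreover have "\<tau> s y (z (Suc l)) = y (z (Suc l))" for l
        using inj by (simp add: \<tau>_def inj_eq)
      ultimately show ?thesis
        using F_eq[OF \<tau>_N[OF y s]] F_eq[OF M_N[OF y]]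
        by (simp add: pd_D[OF y] right_diff_distrib sum_subtractf del: sum.lessThan_Suc)
    qed
    have pd_D_0: "pd c D y = 0" if "y \<in> M" "c \<in> insert c\<^sub>0 (range z)" for y c
      by (rule chain_kernel[OF eq_D _ that])
        (use pd_D pd_high M_N \<tau>_N s in auto)
    \<comment> \<open>Move the finitely many coordinates that matter to their values at \<open>p\<close>, one after the other.
      Those outside the chain have these values already.\<close>
    have "override_on x p E \<in> M \<and> D (override_on x p E) = D x" if "finite E" for E
      using that
    proof induction
      case empty
      then show ?case using x by simp
    next
      case (insert c E)
      have upd: "override_on x p (insert c E) = (override_on x p E)(c := p c)"
        by (auto simp: override_on_def)
      have M': "(override_on x p E)(c := p c) \<in> M"
        using insert.IH B(2) by (auto simp: M_def cylinder_def)
      show ?case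
      proof (cases "c \<in> insert c\<^sub>0 (range z)")
        case True
        then show ?thesis
          using constant_along_line[OF pd_D_0 True] insert.IH M' unfolding upd by metis
      next
        case False
        then have "(override_on x p E)(c := p c) = override_on x p E"
          using insert.IH by (auto simp: M_def)
        then show ?thesis using insert.IH unfolding upd by simp
      qed
    qed
    \<comment> \<open>The translation reads the coordinate \<open>z 0\<close> even when \<open>H\<close> does not depend on it.\<close>
    from this[of "insert (z 0) B\<^sub>H"] UH(3)
    have E: "override_on x p (insert (z 0) B\<^sub>H) \<in> M" "D (override_on x p (insert (z 0) B\<^sub>H)) = D x"
      by auto
    have "H (override_on x p (insert (z 0) B\<^sub>H)) = H p"
      by (rule depends_onD[OF UH(5)]) (use N_sub(1) M_N E p_M in auto)
    moreover have "H (\<tau> s (override_on x p (insert (z 0) B\<^sub>H))) = H (\<tau> s p)"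
      by (rule depends_onD[OF UH(5) N_sub(1)[OF \<tau>_N[OF E(1) s]] N_sub(1)[OF \<tau>_N[OF p_M s]]])
        (auto simp: \<tau>_def)
    ultimately show ?thesis using E(2) by (simp add: D_def)
  qed

  have pd_constant: "pd (z 0) H y = pd (z 0) H p" if y: "y \<in> M" "y (z 0) = p (z 0)" for y
  proof -
    have "\<forall>\<^sub>F t in nhds (p (z 0)). dist t (p (z 0)) < r / 2"
      unfolding eventually_nhds_metric using B(2) by (intro exI[of _ "r / 2"]) simp
    then have ev: "\<forall>\<^sub>F t in nhds (p (z 0)). H (p(z 0 := t)) + (H y - H p) = H (y(z 0 := t))"
    proof eventually_elim
      case (elim t)
      then show ?case
        using shift_constant[OF y(1), of "t - p (z 0)"] y(2)
        by (simp add: \<tau>_def dist_real_def)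
    qed
    have "((\<lambda>t. H (p(z 0 := t))) has_field_derivative pd (z 0) H p) (at (p (z 0)))"
      using UH(2,7)
      by (simp add: pd_def has_partials_on_def DERIV_deriv_iff_field_differentiable)
    then have "((\<lambda>t. H (p(z 0 := t)) + (H y - H p)) has_field_derivative pd (z 0) H p) (at (p (z 0)))"
      by (auto intro!: derivative_eq_intros)
    then have "((\<lambda>t. H (y(z 0 := t))) has_field_derivative pd (z 0) H p) (at (p (z 0)))"
      using DERIV_cong_ev[OF refl ev refl] by blast
    then show ?thesis
      using y(2) by (simp add: pd_def DERIV_imp_deriv)
  qed

  have "F x = chain_derivative c\<^sub>0 z (\<lambda>x. H (override_on p x A)) x + pd (z 0) H p * x (z 1)"
    if x: "x \<in> cylinder p B (r / 2)" for x
  proof -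
    let ?y = "override_on p x A"
    have yM: "?y \<in> M"
      using x B(2) by (auto simp: M_def cylinder_def override_on_def A_def)
    have xr: "x \<in> cylinder p B r"
      using x B(2) by (force simp: cylinder_def)
    have y0: "?y (z 0) = p (z 0)" using z0 by simp
    have ySuc: "?y (z (Suc l)) = x (z (Suc l))" for l by (simp add: A_def)
    have mem: "c\<^sub>0 \<in> A" "z (Suc l) \<in> A" for l by (auto simp: A_def)
    have "F x = F ?y"
      using xr M_N[OF yM] by (intro F_cong) (auto simp: N_def)
    also have "\<dots> = pd c\<^sub>0 H ?y + (\<Sum>l<Suc K. ?y (z (Suc l)) * pd (z l) H ?y)"
      by (rule F_eq[OF M_N[OF yM]])
    also have "\<dots> = pd c\<^sub>0 H ?y + (\<Sum>l<K. x (z (Suc (Suc l))) * pd (z (Suc l)) H ?y)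
        + pd (z 0) H p * x (z 1)"
      unfolding sum.lessThan_Suc_shift ySuc pd_constant[OF yM y0] by simp
    also have "\<dots> = chain_derivative c\<^sub>0 z (\<lambda>x. H (override_on p x A)) x + pd (z 0) H p * x (z 1)"
      using pd_high[OF _ M_N[OF yM]] mem z0
      by (subst chain_derivative_eq_sum[of "Suc K"])
        (simp_all add: pd_override_on sum.lessThan_Suc_shift del: sum.lessThan_Suc)
    finally show ?thesis .
  qed
  then show ?thesis
    using eventually_in_cylinder[OF B(1), of "r / 2" p] B(2)
    by (auto elim: eventually_mono)
qed

section \<open>Trivial currents\<close>

lemma eta_coords_eq: "eta_coords = insert Eta (W 0 ` {1..})"
  by (auto simp: eta_coords_def)

lemma xi_coords_eq: "xi_coords = insert Xi ((\<lambda>k. W k 0) ` {1..})"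
  by (auto simp: xi_coords_def)

text \<open>
  The two divergence terms vanish on solutions separately.
\<close>

lemma V_subset_conserved_currents: "V p \<subseteq> conserved_currents p"
proof -
  have "(F, G) \<in> conserved_currents p"
    if "smooth_fun_at eta_coords p F" "smooth_fun_at xi_coords p G" for F G
  proof -
    have "vanishes_on_solutions p (\<lambda>x. D_xi F x + D_eta G x)"
      using D_xi_vanishes_on_solutions[OF that(1)] D_eta_vanishes_on_solutions[OF that(2)]
      unfolding vanishes_on_solutions_def by eventually_elim auto
    then show ?thesis
      using that smooth_fun_at_mono[OF _ subset_UNIV] by (auto simp: conserved_currents_def)
  qed
  then show ?thesis by (auto simp: V_def)
qed

text \<open>
  The witnesses are \<open>H\<close> restricted to the variables of either direction, with a sign for \<open>G\<close>.  The same
  constant \<open>\<partial>H/\<partial>w\<^sub>0\<^sub>0 (p)\<close> appears in both components, which is where the two directions are coupled.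
\<close>

lemma reduced_form_of_trivial_current:
  assumes p: "p \<in> solution_set"
    and F: "smooth_fun_at eta_coords p F" and G: "smooth_fun_at xi_coords p G"
    and H: "differential_function p H"
    and F': "vanishes_on_solutions p F'" and G': "vanishes_on_solutions p G'"
    and FG: "\<forall>\<^sub>F x in nhds p. F x = F' x + D_eta H x \<and> G x = G' x - D_xi H x"
  shows "\<exists>Ft Gt. \<exists>C :: real. smooth_fun_at eta_coords p Ft \<and> smooth_fun_at xi_coords p Gt \<and>
    (\<forall>\<^sub>F x in nhds p. F x = reduced_D_eta Ft x + C * x (W 0 1) \<and>
                     G x = reduced_D_xi Gt x - C * x (W 1 0))"
proof -
  define Ft where "Ft = (\<lambda>x. H (override_on p x eta_coords))"
  define Ht where "Ht = (\<lambda>x. H (override_on p x xi_coords))"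
  define C where "C = pd (W 0 0) H p"
  have Ft: "smooth_fun_at eta_coords p Ft" and Ht: "smooth_fun_at xi_coords p Ht"
    unfolding Ft_def Ht_def by (rule smooth_fun_at_override_on[OF H])+

  have "\<forall>\<^sub>F x in nhds p. F x = chain_derivative Eta (W 0) Ft x + C * x (W 0 1)"
    unfolding Ft_def C_def eta_coords_eq
  proof (rule chain_derivative_potential[OF _ _ H F[unfolded eta_coords_eq]])
    show "\<forall>\<^sub>F x in nhds p. (\<forall>c. c \<notin> insert Eta (range (W 0)) \<longrightarrow> x c = p c) \<longrightarrow>
        F x = chain_derivative Eta (W 0) H x"
      using FG F'[unfolded vanishes_on_solutions_def]
    proof eventually_elim
      case (elim x)
      show ?case
      proof
        assume *: "\<forall>c. c \<notin> insert Eta (range (W 0)) \<longrightarrow> x c = p c"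
        have "x (W k l) = p (W k l)" if "k \<ge> 1" for k l
          using *[rule_format, of "W k l"] that by auto
        then have "x \<in> solution_set"
          using p by (simp add: solution_set_def)
        then show "F x = chain_derivative Eta (W 0) H x"
          using elim D_eta_eq_chain_derivative by simp
      qed
    qed
  qed (auto simp: inj_on_def)
  then have F_eq: "\<forall>\<^sub>F x in nhds p. F x = reduced_D_eta Ft x + C * x (W 0 1)"
    by (simp add: reduced_D_eta_eq_chain_derivative Ft_def pd_override_on W_in_coords)

  \<comment> \<open>On solutions, the sign in the definition of triviality makes \<open>- G\<close> the total derivative of \<open>H\<close>.\<close>
  have "\<forall>\<^sub>F x in nhds p. - 1 * G x = chain_derivative Xi (\<lambda>k. W k 0) Ht x + C * x (W 1 0)"
    unfolding Ht_def C_def xi_coords_eq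
  proof (rule chain_derivative_potential[OF _ _ H smooth_fun_at_cmult[OF G[unfolded xi_coords_eq]]])
    show "\<forall>\<^sub>F x in nhds p. (\<forall>c. c \<notin> insert Xi (range (\<lambda>k. W k 0)) \<longrightarrow> x c = p c) \<longrightarrow>
        - 1 * G x = chain_derivative Xi (\<lambda>k. W k 0) H x"
      using FG G'[unfolded vanishes_on_solutions_def]
    proof eventually_elim
      case (elim x)
      show ?case
      proof
        assume *: "\<forall>c. c \<notin> insert Xi (range (\<lambda>k. W k 0)) \<longrightarrow> x c = p c"
        have "x (W k l) = p (W k l)" if "l \<ge> 1" for k l
          using *[rule_format, of "W k l"] that by auto
        then have "x \<in> solution_set"
          using p by (simp add: solution_set_def)
        then show "- 1 * G x = chain_derivative Xi (\<lambda>k. W k 0) H x"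
          using elim D_xi_eq_chain_derivative by simp
      qed
    qed
  qed (auto simp: inj_on_def)
  then have "\<forall>\<^sub>F x in nhds p. - 1 * G x = reduced_D_xi Ht x + C * x (W 1 0)"
    by (simp add: reduced_D_xi_eq_chain_derivative Ht_def pd_override_on W_in_coords)
  moreover have "\<forall>\<^sub>F x in nhds p. reduced_D_xi (\<lambda>x. - 1 * Ht x) x = - 1 * reduced_D_xi Ht x"
    unfolding reduced_D_xi_eq_total_derivative by (rule total_derivative_cmult[OF Ht])
  ultimately have G_eq: "\<forall>\<^sub>F x in nhds p. G x = reduced_D_xi (\<lambda>x. - 1 * Ht x) x - C * x (W 1 0)"
    by eventually_elim simp
  show ?thesis
    using Ft smooth_fun_at_cmult[OF Ht] eventually_conj[OF F_eq G_eq] by blast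
qed

text \<open>
  The potential is \<open>H = Ft - Gt + C w\<^sub>0\<^sub>0\<close>.  Its total derivatives contain, besides the required terms, \<open>D_eta Gt\<close> and
  \<open>D_xi Ft\<close>; these vanish on solutions and serve as \<open>F'\<close> and \<open>G'\<close>.
\<close>

lemma trivial_current_of_reduced_form:
  assumes Ft: "smooth_fun_at eta_coords p Ft" and Gt: "smooth_fun_at xi_coords p Gt"
    and FG: "\<forall>\<^sub>F x in nhds p. F x = reduced_D_eta Ft x + C * x (W 0 1) \<and>
                            G x = reduced_D_xi Gt x - C * x (W 1 0)"
  shows "(F, G) \<in> V\<^sub>0 p"
proof -
  have "smooth_fun_at eta_coords p (\<lambda>x. reduced_D_eta Ft x + C * x (W 0 1))"
    unfolding reduced_D_eta_eq_total_derivative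
    by (intro smooth_fun_at_add smooth_fun_at_cmult smooth_fun_at_coordinate
        smooth_fun_at_total_derivative[OF inj_W(2) Ft]) (auto simp: W_in_coords)
  then have F: "smooth_fun_at eta_coords p F"
    by (rule smooth_fun_at_cong) (use FG in \<open>auto elim: eventually_mono\<close>)
  have "smooth_fun_at xi_coords p (\<lambda>x. reduced_D_xi Gt x + (- C) * x (W 1 0))"
    unfolding reduced_D_xi_eq_total_derivative
    by (intro smooth_fun_at_add smooth_fun_at_cmult smooth_fun_at_coordinate
        smooth_fun_at_total_derivative[OF inj_W(3) Gt]) (auto simp: W_in_coords)
  then have G: "smooth_fun_at xi_coords p G"
    by (rule smooth_fun_at_cong) (use FG in \<open>auto elim: eventually_mono\<close>)
  have V: "(F, G) \<in> V p" using F G by (simp add: V_def)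

  define K where "K x = - 1 * Gt x + C * x (W 0 0)" for x :: jet
  define H where "H x = Ft x + K x" for x
  have u: "smooth_fun_at UNIV p (\<lambda>x. x (W 0 0))"
    by (rule smooth_fun_at_coordinate) simp
  have Ft': "differential_function p Ft" and Gt': "differential_function p Gt"
    using Ft Gt smooth_fun_at_mono by blast+
  note neg_Gt = smooth_fun_at_cmult[OF Gt', of "- 1"] and Cu = smooth_fun_at_cmult[OF u, of C]
  have K: "differential_function p K"
    unfolding K_def by (rule smooth_fun_at_add[OF neg_Gt Cu])
  have H: "differential_function p H"
    unfolding H_def by (rule smooth_fun_at_add[OF Ft' K])
  have "\<forall>\<^sub>F x in nhds p. total_derivative c I e sh H x =
      total_derivative c I e sh Ft x - total_derivative c I e sh Gt x
        + C * total_derivative c I e sh (\<lambda>x. x (W 0 0)) x"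
    if e: "inj_on e I" for c and I :: "(nat \<times> nat) set" and e sh
    using total_derivative_add[OF e Ft' K, of c sh, folded H_def]
      total_derivative_add[OF e neg_Gt Cu, of c sh, folded K_def]
      total_derivative_cmult[OF Gt', of c I e sh "- 1"] total_derivative_cmult[OF u, of c I e sh C]
    by eventually_elim simp
  note expand = this[OF inj_W(1), of Eta "\<lambda>(k, l). W k (l + 1)", folded D_eta_eq_total_derivative]
    this[OF inj_W(1), of Xi "\<lambda>(k, l). W (k + 1) l", folded D_xi_eq_total_derivative]
  have "\<forall>\<^sub>F x in nhds p. F x = D_eta Gt x + D_eta H x \<and> G x = D_xi Ft x - D_xi H x"
    using expand FG D_eta_eq_reduced[OF Ft] D_xi_eq_reduced[OF Gt]
    by eventually_elim (simp add: D_eta_coordinate D_xi_coordinate)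
  moreover have "differential_function p (D_eta Gt)" "differential_function p (D_xi Ft)"
    unfolding D_eta_eq_total_derivative D_xi_eq_total_derivative
    by (auto intro: smooth_fun_at_total_derivative[OF inj_W(1)] Ft' Gt')
  ultimately have "(F, G) \<in> trivial_currents p"
    using V V_subset_conserved_currents H D_eta_vanishes_on_solutions[OF Gt]
      D_xi_vanishes_on_solutions[OF Ft]
    unfolding trivial_currents_def by blast
  with V show ?thesis by (simp add: V\<^sub>0_def)
qed

theorem lemma3:
  fixes p :: jet
  assumes "p \<in> solution_set"
  shows "V p \<subseteq> conserved_currents p \<and>
    V\<^sub>0 p = {(F, G). \<exists>Ft Gt. \<exists>C :: real.
              smooth_fun_at eta_coords p Ft \<and> smooth_fun_at xi_coords p Gt \<and>
              (\<forall>\<^sub>F x in nhds p. F x = reduced_D_eta Ft x + C * x (W 0 1) \<and>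
                               G x = reduced_D_xi Gt x - C * x (W 1 0))}"
    (is "_ \<and> V\<^sub>0 p = ?R")
proof
  show "V\<^sub>0 p = ?R"
  proof (intro equalityI subsetI)
    fix X assume "X \<in> V\<^sub>0 p"
    then show "X \<in> ?R"
      using reduced_form_of_trivial_current[OF assms]
      unfolding V\<^sub>0_def V_def trivial_currents_def by blast
  next
    fix X assume "X \<in> ?R"
    then show "X \<in> V\<^sub>0 p"
      using trivial_current_of_reduced_form by blast
  qed
qed (rule V_subset_conserved_currents)

end
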